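(* Let $\lambda,\eta,c$ be positive real numbers with $\lambda>1$ such that one of the following holds: $\eta=\lambda$ and $c\ge\frac12$; or $\eta\in(\lambda,\lambda^2)$; or $\eta=\lambda^2$ and $0<c\le 1$. Then there exist a topological dynamical system $(X,T)$ and a continuous involution $\imath$ on $X$ commuting with $T$ such that, writing $(\overline{X},\overline{T})$ for the system obtained from $(X,T)$ by halving with respect to $\imath$, $$\mathsf{O}_T(n)\sim\lambda^n\quad\text{and}\quad \mathsf{O}_{\overline{T}}(n)\sim c\,\eta^n\quad\text{as } n\to\infty.$$
   Context: A topological dynamical system is a pair $(X,T)$ where $X$ is a compact metric space and $T:X\to X$ is a homeomorphism that has a fixed point and has, for each $n\ge1$, only finitely many points $x$ with $T^n(x)=x$. An involution is a map $\imath$ with $\imath\circ\imath=\mathrm{id}$ (the identity is allowed). Halving: given a continuous involution $\imath:X\to X$ commuting with $T$, let $\approx$ be the equivalence relation on $X$ whose classes are the sets $[x]=\{x,\imath(x)\}$. The halved system $(\overline{X},\overline{T})$ consists of the quotient space $\overline{X}=X/{\approx}$ and the well-defined map $\overline{T}([x])=[T(x)]$. For a map $S:Y\to Y$ and $n\ge1$, $\mathsf{O}_S(n)$ is the number of closed orbits of $S$ of length exactly $n$ (a closed orbit of length $n$ is a set $\{y,S(y),\dots,S^{n-1}(y)\}$ consisting of $n$ distinct points, with $S^n(y)=y$). For sequences, $u_n\sim v_n$ as $n\to\infty$ means $u_n/v_n\to1$. *)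

theory Defs
  imports "HOL-Analysis.Analysis" "HOL-Library.Landau_Symbols"
begin

text \<open>
  Self-maps of a space are total functions of the ambient type; only their values on the
  carrier matter.

  A compact metric space has at most the cardinality of the continuum, hence is isometric to
  some \<open>X :: real metric\<close>, a set of reals with an arbitrary (not the usual) metric.
  So an existential statement over \<open>real metric\<close> ranges over all compact metric spaces.
\<close>

definition topological_dynamical_system :: "'a metric \<Rightarrow> ('a \<Rightarrow> 'a) \<Rightarrow> bool" where
  "topological_dynamical_system X T \<longleftrightarrow>
     compact_space (mtopology_of X) \<and>
     homeomorphic_map (mtopology_of X) (mtopology_of X) T \<and>
     (\<exists>x\<in>mspace X. T x = x) \<and>
     (\<forall>n\<ge>1. finite {x \<in> mspace X. (T ^^ n) x = x})"

definition continuous_involution :: "'a topology \<Rightarrow> ('a \<Rightarrow> 'a) \<Rightarrow> bool" where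
  "continuous_involution X i \<longleftrightarrow>
     continuous_map X X i \<and> (\<forall>x\<in>topspace X. i (i x) = x)"

definition closed_orbits :: "'a set \<Rightarrow> ('a \<Rightarrow> 'a) \<Rightarrow> nat \<Rightarrow> 'a set set" where
  "closed_orbits Y S n =
     {(\<lambda>k. (S ^^ k) y) ` {..<n} | y.
        y \<in> Y \<and> inj_on (\<lambda>k. (S ^^ k) y) {..<n} \<and> (S ^^ n) y = y}"

definition orbit_count :: "'a set \<Rightarrow> ('a \<Rightarrow> 'a) \<Rightarrow> nat \<Rightarrow> nat" where
  "orbit_count Y S n = card (closed_orbits Y S n)"

definition quotient_topology :: "'a topology \<Rightarrow> ('a \<times> 'a) set \<Rightarrow> 'a set topology" where
  "quotient_topology X r = topology (\<lambda>U. U \<subseteq> topspace X // r \<and> openin X (\<Union>U))"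

definition halving_rel :: "'a set \<Rightarrow> ('a \<Rightarrow> 'a) \<Rightarrow> ('a \<times> 'a) set" where
  "halving_rel A i = {(x, y). x \<in> A \<and> y \<in> {x, i x}}"

definition halved_space :: "'a topology \<Rightarrow> ('a \<Rightarrow> 'a) \<Rightarrow> 'a set topology" where
  "halved_space X i = quotient_topology X (halving_rel (topspace X) i)"

text \<open>
  As usual for functions on quotients, the union over the representatives of a class is the
  common value of the lifted function; see \<open>halved_map_class\<close> below.
\<close>

definition halved_map :: "'a topology \<Rightarrow> ('a \<Rightarrow> 'a) \<Rightarrow> ('a \<Rightarrow> 'a) \<Rightarrow> 'a set \<Rightarrow> 'a set" where
  "halved_map X i T C = (\<Union>x\<in>C. halving_rel (topspace X) i `` {T x})"

lemma halving_rel_class: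
  "x \<in> A \<Longrightarrow> halving_rel A i `` {x} = {x, i x}"
  by (auto simp: halving_rel_def)

lemma equiv_halving_rel:
  assumes "i ` A \<subseteq> A" "\<forall>x\<in>A. i (i x) = x"
  shows "equiv A (halving_rel A i)"
  using assms
  by (auto intro!: equivI refl_onI symI transI simp: halving_rel_def)

lemma openin_quotient_topology:
  assumes r: "equiv (topspace X) r"
  shows "openin (quotient_topology X r) U \<longleftrightarrow> U \<subseteq> topspace X // r \<and> openin X (\<Union>U)"
proof -
  have *: "\<Union>(U \<inter> V) = \<Union>U \<inter> \<Union>V"
    if "U \<subseteq> topspace X // r" "V \<subseteq> topspace X // r" for U V
    using that quotient_disj[OF r] by fast
  have "istopology (\<lambda>U. U \<subseteq> topspace X // r \<and> openin X (\<Union>U))"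
    unfolding istopology_def
  proof (intro conjI allI impI)
    fix K assume "\<forall>k\<in>K. k \<subseteq> topspace X // r \<and> openin X (\<Union>k)"
    moreover have "\<Union>(\<Union>K) = (\<Union>k\<in>K. \<Union>k)" by auto
    ultimately show "openin X (\<Union>(\<Union>K))" by auto
  qed (auto simp: *)
  then show ?thesis
    by (simp add: quotient_topology_def)
qed

lemma topspace_quotient_topology:
  assumes r: "equiv (topspace X) r"
  shows "topspace (quotient_topology X r) = topspace X // r"
proof
  show "topspace (quotient_topology X r) \<subseteq> topspace X // r"
    using openin_quotient_topology[OF r] openin_topspace by blast
  show "topspace X // r \<subseteq> topspace (quotient_topology X r)"
    by (rule openin_subset) (simp add: openin_quotient_topology[OF r] Union_quotient[OF r])
qed

lemma quotient_map_quotient_topology: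
  assumes r: "equiv (topspace X) r"
  shows "quotient_map X (quotient_topology X r) (\<lambda>x. r `` {x})"
  unfolding quotient_map_def topspace_quotient_topology[OF r]
proof (intro conjI allI impI)
  show "(\<lambda>x. r `` {x}) ` topspace X = topspace X // r"
    by (auto simp: quotient_def)
  fix U assume U: "U \<subseteq> topspace X // r"
  have "{x \<in> topspace X. r `` {x} \<in> U} = \<Union>U"
  proof (intro set_eqI iffI)
    fix x assume "x \<in> {x \<in> topspace X. r `` {x} \<in> U}"
    then show "x \<in> \<Union>U" using equiv_class_self[OF r, of x] by blast
  next
    fix x assume "x \<in> \<Union>U"
    then obtain C where C: "C \<in> U" "x \<in> C" by auto
    then obtain y where "y \<in> topspace X" "C = r `` {y}"
      using U by (auto simp: quotient_def)
    then have "C = r `` {x}" "x \<in> topspace X"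
      using C equiv_class_eq[OF r] equiv_type[OF r] by auto
    then show "x \<in> {x \<in> topspace X. r `` {x} \<in> U}" using C by auto
  qed
  then show "openin X {x \<in> topspace X. r `` {x} \<in> U} \<longleftrightarrow> openin (quotient_topology X r) U"
    using U by (simp add: openin_quotient_topology[OF r])
qed

lemma topspace_halved_space:
  assumes "continuous_involution X i"
  shows "topspace (halved_space X i) = (\<lambda>x. {x, i x}) ` topspace X"
proof -
  have "equiv (topspace X) (halving_rel (topspace X) i)"
    using assms equiv_halving_rel continuous_map_image_subset_topspace
    unfolding continuous_involution_def by metis
  then show ?thesis
    unfolding halved_space_def
    by (auto simp: topspace_quotient_topology quotient_def halving_rel_class)
qed

lemma halved_map_class:
  assumes i: "continuous_involution X i"
    and T: "T ` topspace X \<subseteq> topspace X" "\<forall>x\<in>topspace X. T (i x) = i (T x)"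
    and x: "x \<in> topspace X"
  shows "halved_map X i T {x, i x} = {T x, i (T x)}"
proof -
  have "T x \<in> topspace X" "i (T x) \<in> topspace X" "i (i (T x)) = T x"
    using i T x by (auto simp: continuous_involution_def continuous_map_def)
  then show ?thesis
    using T x by (auto simp: halved_map_def halving_rel_class)
qed

end

theory Submission
  imports Defs "HOL-Library.Countable"
begin

text \<open>
  The space is the one-point compactification of a discrete union of finite cycles, on which \<open>T\<close>
  acts by rotation. The involution either swaps two cycles of length \<open>n\<close>, which become one cycle of
  length \<open>n\<close>, or rotates a cycle of even length \<open>2 n\<close> by half a turn, which makes it a cycle of length
  \<open>n\<close>. With \<open>b n\<close> swapped pairs of length \<open>n\<close> and \<open>d n\<close> half-turned cycles of length \<open>2 n\<close>, the
  orbit counts are \<open>2 b n + d (n / 2)\<close> (second term for even \<open>n\<close>) and \<open>b n + d n\<close>. For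
  \<open>eta = lam\<close> take \<open>d n\<close> near \<open>(c - 1/2) lam ^ n\<close>, otherwise \<open>d n\<close> near \<open>c eta ^ n\<close>; in all cases
  \<open>b n\<close> is chosen to bring the first count up to \<open>lam ^ n\<close>.
\<close>

section \<open>Compact ultrametric spaces with one accumulation point\<close>

text \<open>Finiteness above every positive threshold makes the weight tend to 0 along any sequence
  of distinct points, so these can only accumulate at \<open>z\<close>.\<close>

locale vanishing_weight =
  fixes S :: "'a set" and z :: 'a and w :: "'a \<Rightarrow> real"
  assumes z: "z \<in> S" "w z = 0"
    and pos: "x \<in> S \<Longrightarrow> x \<noteq> z \<Longrightarrow> w x > 0"
    and fin: "e > 0 \<Longrightarrow> finite {x \<in> S. w x \<ge> e}"
begin

text \<open>An ultrametric: a point other than \<open>z\<close> is at least its own weight away from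
  all others, hence isolated, while \<open>x\<close> has distance \<open>w x\<close> from
  \<open>z\<close>.\<close>

definition wdist :: "'a \<Rightarrow> 'a \<Rightarrow> real" where
  "wdist x y = (if x \<in> S \<and> y \<in> S \<and> x \<noteq> y then max (w x) (w y) else 0)"

lemma wdist_eq: "x \<in> S \<Longrightarrow> y \<in> S \<Longrightarrow> x \<noteq> y \<Longrightarrow> wdist x y = max (w x) (w y)"
  by (simp add: wdist_def)

lemma weight_nonneg: "x \<in> S \<Longrightarrow> w x \<ge> 0"
  using z pos[of x] by (cases "x = z") auto

sublocale Metric_space S wdist
proof
  fix x y
  show "wdist x y \<ge> 0"
    using weight_nonneg by (auto simp: wdist_def le_max_iff_disj)
  show "wdist x y = wdist y x"
    by (auto simp: wdist_def)
  assume xy: "x \<in> S" "y \<in> S"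
  then have "max (w x) (w y) > 0" if "x \<noteq> y"
    using that pos[of x] pos[of y] by (cases "x = z") (auto simp: less_max_iff_disj)
  with xy show "wdist x y = 0 \<longleftrightarrow> x = y"
    by (auto simp: wdist_def)
next
  fix x y u assume "x \<in> S" "y \<in> S" "u \<in> S"
  then show "wdist x u \<le> wdist x y + wdist y u"
    using weight_nonneg[of x] weight_nonneg[of y] weight_nonneg[of u]
    by (auto simp: wdist_def)
qed

text \<open>Bolzano-Weierstrass: an infinite set keeps a point after removing \<open>z\<close> and
  the finitely many points of weight at least \<open>r\<close>, and its distance to \<open>z\<close>
  is its weight.\<close>

lemma compact_space_wdist: "compact_space mtopology"
proof -
  have "z \<in> mtopology derived_set_of A" if A: "A \<subseteq> S" "infinite A" for A
  proof -
    have "\<exists>y\<in>A - {z}. y \<in> mball z r" if "r > 0" for r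
    proof -
      have "infinite (A - {x \<in> S. w x \<ge> r} - {z})"
        using A(2) fin[OF \<open>r > 0\<close>] by (simp add: Diff_infinite_finite)
      then have "A - {x \<in> S. w x \<ge> r} - {z} \<noteq> {}"
        by (metis finite.emptyI)
      then obtain y where y: "y \<in> A" "\<not> w y \<ge> r" "y \<noteq> z"
        using A(1) by auto
      with A(1) that z have "y \<in> mball z r"
        by (auto simp: wdist_eq)
      with y show ?thesis by blast
    qed
    then show ?thesis
      using A(1) z(1) by (auto simp: metric_derived_set_of)
  qed
  then show ?thesis
    by (metis compact_space_eq_Bolzano_Weierstrass empty_iff)
qed

text \<open>The distance depends only on the weights and on whether the points coincide, so such a
  bijection is an isometry.\<close>

lemma homeomorphic_map_weight_preserving:
  assumes "bij_betw f S S" "\<And>x. x \<in> S \<Longrightarrow> w (f x) = w x"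
  shows "homeomorphic_map mtopology mtopology f"
proof -
  interpret Metric_space12 S wdist S wdist
    by unfold_locales
  have "wdist (f x) (f y) = wdist x y" if "x \<in> S" "y \<in> S" for x y
    using assms that by (auto simp: wdist_def bij_betw_def inj_on_def)
  then show ?thesis
    using assms(1) by (intro isometry_imp_homeomorphic_map) (auto simp: bij_betw_def)
qed

end

section \<open>Closed orbits under conjugacy and halving\<close>

lemma orbit_count_conjugate:
  assumes h: "bij_betw h Y Z" and S: "S ` Y \<subseteq> Y"
    and conj: "\<And>y. y \<in> Y \<Longrightarrow> h (S y) = R (h y)"
  shows "orbit_count Y S n = orbit_count Z R n"
proof -
  have it: "(S ^^ k) y \<in> Y \<and> (R ^^ k) (h y) = h ((S ^^ k) y)" if "y \<in> Y" for y k
    using that S conj by (induction k) auto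
  have inj: "inj_on h Y" and Z: "Z = h ` Y"
    using h by (auto simp: bij_betw_def)
  have iff: "inj_on (\<lambda>k. (R ^^ k) (h y)) {..<n} \<longleftrightarrow> inj_on (\<lambda>k. (S ^^ k) y) {..<n}"
    "(R ^^ n) (h y) = h y \<longleftrightarrow> (S ^^ n) y = y"
    "(\<lambda>k. (R ^^ k) (h y)) ` {..<n} = h ` (\<lambda>k. (S ^^ k) y) ` {..<n}" if "y \<in> Y" for y
    using it[OF that] that inj_on_eq_iff[OF inj, of _ y]
    by (simp_all add: inj_on_def inj_on_eq_iff[OF inj] image_image)
  \<comment> \<open>Orbits as images of their periodic points; the fresh type variable lets this
    serve both systems.\<close>
  have *: "closed_orbits Y S n = (\<lambda>y. (\<lambda>k. (S ^^ k) y) ` {..<n}) `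
      {y \<in> Y. inj_on (\<lambda>k. (S ^^ k) y) {..<n} \<and> (S ^^ n) y = y}" for Y :: "'c set" and S
    by (auto simp: closed_orbits_def)
  have **: "{z \<in> Z. inj_on (\<lambda>k. (R ^^ k) z) {..<n} \<and> (R ^^ n) z = z} =
      h ` {y \<in> Y. inj_on (\<lambda>k. (S ^^ k) y) {..<n} \<and> (S ^^ n) y = y}"
    unfolding Z by (auto simp: iff(1,2))
  have "closed_orbits Z R n = (`) h ` closed_orbits Y S n"
    unfolding * ** image_image by (intro image_cong refl) (auto simp: it image_image)
  moreover have "closed_orbits Y S n \<subseteq> Pow Y"
    using it by (auto simp: closed_orbits_def)
  then have "inj_on ((`) h) (closed_orbits Y S n)"
    by (rule inj_on_subset[OF inj_on_image_Pow[OF inj]])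
  ultimately show ?thesis
    by (simp add: orbit_count_def card_image)
qed

text \<open>Replaces the halved system by a concrete model: \<open>g\<close> has the classes
  \<open>{x, i x}\<close> as fibres and intertwines \<open>T\<close> with \<open>R\<close>, so it
  descends to a bijective conjugacy onto \<open>Z\<close>.\<close>

lemma orbit_count_halved:
  assumes i: "continuous_involution X i"
    and T: "T ` topspace X \<subseteq> topspace X" "\<forall>x\<in>topspace X. T (i x) = i (T x)"
    and g: "g ` topspace X = Z"
    and fib: "\<And>x y. x \<in> topspace X \<Longrightarrow> y \<in> topspace X \<Longrightarrow> g x = g y \<longleftrightarrow> y = x \<or> y = i x"
    and conj: "\<And>x. x \<in> topspace X \<Longrightarrow> g (T x) = R (g x)"
  shows "orbit_count (topspace (halved_space X i)) (halved_map X i T) n = orbit_count Z R n"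
proof (rule orbit_count_conjugate)
  \<comment> \<open>\<open>g\<close> is constant on each class, so its image there is a
    singleton.\<close>
  define h where "h C = the_elem (g ` C)" for C
  have iX: "i x \<in> topspace X" if "x \<in> topspace X" for x
    using i that continuous_map_image_subset_topspace unfolding continuous_involution_def by blast
  have h: "h {x, i x} = g x" if "x \<in> topspace X" for x
  proof -
    have "g x = g (i x)" unfolding fib[OF that iX[OF that]] by (rule disjI2[OF refl])
    then have "g ` {x, i x} = {g x}" by simp
    then show ?thesis unfolding h_def by simp
  qed
  note tops = topspace_halved_space[OF i] and hm = halved_map_class[OF i T]
  have cls: "{x, i x} = {y, i y}" if "x \<in> topspace X" "y \<in> topspace X" "g x = g y" for x y
  proof -
    have "y = x \<or> y = i x" using fib that by blast
    moreover have "i (i x) = x" using i that(1) by (simp add: continuous_involution_def)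
    ultimately show ?thesis by auto
  qed
  have "inj_on h ((\<lambda>x. {x, i x}) ` topspace X)"
    unfolding inj_on_def ball_simps(9)
  proof (intro ballI impI)
    fix x y assume "x \<in> topspace X" "y \<in> topspace X" "h {x, i x} = h {y, i y}"
    then show "{x, i x} = {y, i y}"
      by (intro cls) (simp_all only: h)
  qed
  moreover have "h ` (\<lambda>x. {x, i x}) ` topspace X = Z"
    unfolding image_image g[symmetric] using h by (rule image_cong[OF refl])
  ultimately show "bij_betw h (topspace (halved_space X i)) Z"
    unfolding bij_betw_def tops by blast
  show "halved_map X i T ` topspace (halved_space X i) \<subseteq> topspace (halved_space X i)"
    unfolding tops image_image
  proof (rule image_subsetI)
    fix x assume x: "x \<in> topspace X"
    then have "T x \<in> topspace X" using T(1) by blast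
    then show "halved_map X i T {x, i x} \<in> (\<lambda>x. {x, i x}) ` topspace X"
      unfolding hm[OF x] by (rule imageI)
  qed
  fix C assume "C \<in> topspace (halved_space X i)"
  then obtain x where x: "x \<in> topspace X" "C = {x, i x}"
    unfolding tops by (rule imageE)
  moreover have "T x \<in> topspace X" using x(1) T(1) by blast
  ultimately show "h (halved_map X i T C) = R (h C)"
    unfolding x(2) hm[OF x(1)] by (simp only: h conj x(1))
qed

section \<open>Rotations on disjoint cycles\<close>

text \<open>
  The triple \<open>(n, j, k)\<close> is the \<open>k\<close>-th point of the \<open>j\<close>-th cycle of length \<open>n\<close>. A cycle with label \<open>n = 0\<close> is a single fixed point; it serves
  as the point at infinity, in accordance with the junk value \<open>inverse 0 = 0\<close> of the weight.
\<close>

definition cycles :: "(nat \<Rightarrow> nat) \<Rightarrow> (nat \<times> nat \<times> nat) set" where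
  "cycles M = {(n, j, k). j < M n \<and> k < max 1 n}"

definition rotate_cycles :: "nat \<times> nat \<times> nat \<Rightarrow> nat \<times> nat \<times> nat" where
  "rotate_cycles = (\<lambda>(n, j, k). (n, j, Suc k mod max 1 n))"

definition cycle_weight :: "nat \<times> nat \<times> nat \<Rightarrow> real" where
  "cycle_weight = (\<lambda>(n, j, k). inverse (real n))"

lemma rotate_cycles_funpow:
  "k < max 1 n \<Longrightarrow> (rotate_cycles ^^ r) (n, j, k) = (n, j, (k + r) mod max 1 n)"
  by (induction r) (auto simp: rotate_cycles_def mod_Suc_eq)

lemma rotate_cycles_in: "x \<in> cycles M \<Longrightarrow> rotate_cycles x \<in> cycles M"
  by (auto simp: cycles_def rotate_cycles_def)

lemma rotate_cycles_periodic_iff: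
  "k < max 1 n \<Longrightarrow> (rotate_cycles ^^ r) (n, j, k) = (n, j, k) \<longleftrightarrow> max 1 n dvd r"
proof -
  assume k: "k < max 1 n"
  have "(k + r) mod max 1 n = k \<longleftrightarrow> (k + r) mod max 1 n = k mod max 1 n"
    using k by simp
  also have "\<dots> \<longleftrightarrow> max 1 n dvd r"
    by (simp add: mod_eq_dvd_iff_nat)
  finally show ?thesis using k by (simp add: rotate_cycles_funpow)
qed

lemma finite_cycles_le: "finite {(n, j, k) \<in> cycles M. n \<le> N}"
proof (rule finite_subset)
  show "{(n, j, k) \<in> cycles M. n \<le> N} \<subseteq> (SIGMA n:{..N}. {..<M n} \<times> {..<max 1 n})"
    by (auto simp: cycles_def)
qed auto

lemma finite_rotate_cycles_periodic:
  assumes "r \<ge> 1"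
  shows "finite {x \<in> cycles M. (rotate_cycles ^^ r) x = x}"
proof (rule finite_subset[OF _ finite_cycles_le])
  show "{x \<in> cycles M. (rotate_cycles ^^ r) x = x} \<subseteq> {(n, j, k) \<in> cycles M. n \<le> r}"
    using assms by (auto simp: cycles_def rotate_cycles_periodic_iff dest!: dvd_imp_le)
qed

lemma finite_cycle_weight_ge:
  assumes "e > 0"
  shows "finite {x \<in> cycles M. cycle_weight x \<ge> e}"
proof (rule finite_subset[OF _ finite_cycles_le])
  have "n \<le> nat \<lceil>1 / e\<rceil>" if "inverse (real n) \<ge> e" for n
  proof (cases "n = 0")
    case False
    then have "real n \<le> 1 / e" using that assms by (simp add: field_simps)
    then show ?thesis by linarith
  qed simp
  then show "{x \<in> cycles M. cycle_weight x \<ge> e} \<subseteq> {(n, j, k) \<in> cycles M. n \<le> nat \<lceil>1 / e\<rceil>}"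
    by (auto simp: cycle_weight_def)
qed

lemma bij_betw_rotate_cycles: "bij_betw rotate_cycles (cycles M) (cycles M)"
proof (rule bij_betw_byWitness)
  \<comment> \<open>The inverse rotation is the power one short of a full turn; the exponent varies
    with the cycle.\<close>
  let ?R = "\<lambda>(n, j, k). (rotate_cycles ^^ (max 1 n - 1)) (n, j, k)"
  have *: "rotate_cycles (?R (n, j, k)) = (n, j, k)" if "k < max 1 n" for n j k
  proof -
    have "rotate_cycles (?R (n, j, k)) = (rotate_cycles ^^ Suc (max 1 n - 1)) (n, j, k)"
      by (simp only: funpow.simps o_apply prod.case)
    also have "Suc (max 1 n - 1) = max 1 n" by simp
    finally show ?thesis using rotate_cycles_periodic_iff[OF that] by simp
  qed
  then show "\<forall>x\<in>cycles M. rotate_cycles (?R x) = x"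
    by (auto simp: cycles_def)
  have "?R (rotate_cycles (n, j, k)) = rotate_cycles (?R (n, j, k))" for n j k
    by (simp add: funpow_swap1 rotate_cycles_def)
  with * show "\<forall>x\<in>cycles M. ?R (rotate_cycles x) = x"
    by (auto simp: cycles_def)
  show "rotate_cycles ` cycles M \<subseteq> cycles M" "?R ` cycles M \<subseteq> cycles M"
    by (auto simp: rotate_cycles_in) (auto simp: cycles_def rotate_cycles_funpow)
qed

text \<open>Each cycle with label \<open>n\<close> is one orbit. Labels and orbit lengths match from
  2 on, whereas labels 0 and 1 both give fixed points.\<close>

lemma orbit_count_rotate_cycles:
  assumes "n \<ge> 2"
  shows "orbit_count (cycles M) rotate_cycles n = M n"
proof -
  have max: "max 1 n = n" using assms by simp
  \<comment> \<open>Returning after \<open>n\<close> steps makes the cycle length a divisor of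
    \<open>n\<close>; distinctness of the first \<open>n\<close> iterates excludes a proper
    one.\<close>
  have iff: "inj_on (\<lambda>r. (rotate_cycles ^^ r) (p, j, k)) {..<n} \<and>
      (rotate_cycles ^^ n) (p, j, k) = (p, j, k) \<longleftrightarrow> p = n" (is "?L \<longleftrightarrow> _")
    if k: "k < max 1 p" for p j k
  proof
    assume L: ?L
    then have "max 1 p dvd n" using k rotate_cycles_periodic_iff by blast
    moreover have "\<not> max 1 p < n"
    proof
      assume "max 1 p < n"
      then have "max 1 p \<in> {..<n}" "0 \<in> {..<n}" by simp_all
      moreover have "(rotate_cycles ^^ max 1 p) (p, j, k) = (rotate_cycles ^^ 0) (p, j, k)"
        using k rotate_cycles_periodic_iff by simp
      ultimately have "max 1 p = 0"
        using inj_onD[OF conjunct1[OF L]] by blast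
      then show False by simp
    qed
    ultimately have "max 1 p = n"
      using assms dvd_imp_le[of "max 1 p" n] by linarith
    then show "p = n"
      using assms by linarith
  next
    assume "p = n"
    have "inj_on (\<lambda>r. (rotate_cycles ^^ r) (p, j, k)) {..<n}"
    proof (rule inj_onI)
      fix r s assume rs: "r \<in> {..<n}" "s \<in> {..<n}"
        and "(rotate_cycles ^^ r) (p, j, k) = (rotate_cycles ^^ s) (p, j, k)"
      then have "(k + r) mod n = (k + s) mod n"
        unfolding rotate_cycles_funpow[OF k] unfolding \<open>p = n\<close> max by blast
      then have "(int k + int r) mod int n = (int k + int s) mod int n"
        by (metis of_nat_add of_nat_mod)
      then have "int r mod int n = int s mod int n"
        by (simp add: mod_eq_dvd_iff)
      with rs show "r = s" by simp
    qed
    moreover have "(rotate_cycles ^^ n) (p, j, k) = (p, j, k)"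
      using rotate_cycles_periodic_iff[OF k] \<open>p = n\<close> max by simp
    ultimately show ?L by blast
  qed
  have orbit: "(\<lambda>r. (rotate_cycles ^^ r) (n, j, k)) ` {..<n} = {n} \<times> {j} \<times> {..<n}"
    if "k < n" for j k
  proof -
    have "s \<in> (\<lambda>r. (k + r) mod n) ` {..<n}" if "s < n" for s
    proof
      \<comment> \<open>Getting from position \<open>k\<close> to \<open>s\<close> takes
        \<open>n - k + s\<close> steps modulo \<open>n\<close>; the subtraction is genuine since
        \<open>k < n\<close>.\<close>
      have "(k + (n - k + s) mod n) mod n = (k + (n - k + s)) mod n"
        by (rule mod_add_right_eq)
      also have "k + (n - k + s) = n + s" using \<open>k < n\<close> by simp
      finally show "s = (k + (n - k + s) mod n) mod n" using that by simp
    qed (use assms in auto)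
    moreover have "(\<lambda>r. (k + r) mod n) ` {..<n} \<subseteq> {..<n}"
      using assms by auto
    ultimately have "(\<lambda>r. (k + r) mod n) ` {..<n} = {..<n}"
      by blast
    moreover have "(\<lambda>r. (rotate_cycles ^^ r) (n, j, k)) ` {..<n} =
        (\<lambda>s. (n, j, s)) ` (\<lambda>r. (k + r) mod n) ` {..<n}"
      using that max by (simp only: rotate_cycles_funpow image_image)
    ultimately show ?thesis by auto
  qed
  have "closed_orbits (cycles M) rotate_cycles n =
      {{n} \<times> {j} \<times> {..<n} | j k. (n, j, k) \<in> cycles M}" (is "?A = ?B")
  proof
    show "?A \<subseteq> ?B"
    proof
      fix C assume "C \<in> ?A"
      then obtain p j k where y: "(p, j, k) \<in> cycles M"
        and per: "inj_on (\<lambda>r. (rotate_cycles ^^ r) (p, j, k)) {..<n}"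
          "(rotate_cycles ^^ n) (p, j, k) = (p, j, k)"
        and C: "C = (\<lambda>r. (rotate_cycles ^^ r) (p, j, k)) ` {..<n}"
        unfolding closed_orbits_def by auto
      from y have k: "k < max 1 p" by (simp add: cycles_def)
      then have p: "p = n" using iff per by blast
      have "C = {n} \<times> {j} \<times> {..<n}"
        using orbit[of k j] k unfolding C p max by blast
      with y show "C \<in> ?B" unfolding p by blast
    qed
    show "?B \<subseteq> ?A"
    proof
      fix C assume "C \<in> ?B"
      then obtain j k where C: "C = {n} \<times> {j} \<times> {..<n}" and y: "(n, j, k) \<in> cycles M"
        by blast
      from y have k: "k < max 1 n" by (simp add: cycles_def)
      then have "C = (\<lambda>r. (rotate_cycles ^^ r) (n, j, k)) ` {..<n}"
        using C orbit max by metis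
      with y iff[OF k] show "C \<in> ?A"
        unfolding closed_orbits_def by blast
    qed
  qed
  also have "\<dots> = (\<lambda>j. {n} \<times> {j} \<times> {..<n}) ` {..<M n}"
  proof -
    have "(\<exists>k. (n, j, k) \<in> cycles M) \<longleftrightarrow> j < M n" for j
      by (auto simp: cycles_def intro: exI[of _ 0])
    then show ?thesis by blast
  qed
  finally have "closed_orbits (cycles M) rotate_cycles n = (\<lambda>j. {n} \<times> {j} \<times> {..<n}) ` {..<M n}" .
  moreover have "inj_on (\<lambda>j. {n} \<times> {j} \<times> {..<n}) {..<M n}"
    using assms by (auto simp: inj_on_def times_eq_iff lessThan_empty_iff)
  ultimately show ?thesis
    by (simp add: orbit_count_def card_image)
qed

section \<open>An involution swapping cycles in pairs or turning them halfway\<close>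

definition double_cycles :: "(nat \<Rightarrow> nat) \<Rightarrow> (nat \<Rightarrow> nat) \<Rightarrow> nat \<Rightarrow> nat" where
  "double_cycles b d n = 2 * b n + (if even n then d (n div 2) else 0)"

text \<open>On \<open>cycles (double_cycles b d)\<close>, indices below \<open>2 * b n\<close> form
  exchanged pairs \<open>j\<close>, \<open>j + b n\<close>; the remaining ones occur only for even
  \<open>n\<close> and are turned halfway.\<close>

definition cycle_swap :: "(nat \<Rightarrow> nat) \<Rightarrow> nat \<times> nat \<times> nat \<Rightarrow> nat \<times> nat \<times> nat" where
  "cycle_swap b = (\<lambda>(n, j, k).
     if j < b n then (n, j + b n, k)
     else if j < 2 * b n then (n, j - b n, k)
     else (n, j, (k + n div 2) mod max 1 n))"

text \<open>A concrete quotient map: a swapped pair collapses to its first member, and a turned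
  cycle folds to half its length, placed behind the \<open>b (n div 2)\<close> cycles already
  there.\<close>

definition cycle_halve :: "(nat \<Rightarrow> nat) \<Rightarrow> nat \<times> nat \<times> nat \<Rightarrow> nat \<times> nat \<times> nat" where
  "cycle_halve b = (\<lambda>(n, j, k).
     if j < b n then (n, j, k)
     else if j < 2 * b n then (n, j - b n, k)
     else (n div 2, b (n div 2) + (j - 2 * b n), k mod max 1 (n div 2)))"

text \<open>Writing the turned label as \<open>2 * n\<close> and indices as offsets makes the
  halvings and truncated subtractions of the two maps simplify away.\<close>

lemma double_cycles_cases:
  assumes "x \<in> cycles (double_cycles b d)"
  obtains (left) n j k where "x = (n, j, k)" "j < b n" "k < max 1 n"
  | (right) n j k where "x = (n, b n + j, k)" "j < b n" "k < max 1 n"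
  | (turn) n j k where "x = (2 * n, 2 * b (2 * n) + j, k)" "j < d n" "k < max 1 (2 * n)"
proof -
  obtain n j k where x: "x = (n, j, k)" "j < double_cycles b d n" "k < max 1 n"
    using assms by (auto simp: cycles_def)
  consider "j < b n" | "b n \<le> j" "j < 2 * b n" | "2 * b n \<le> j"
    by linarith
  then show thesis
  proof cases
    case 1
    then show thesis using left x by blast
  next
    case 2
    then show thesis using right[of n "j - b n" k] x by simp
  next
    case 3
    then have "even n" "j - 2 * b n < d (n div 2)"
      using x(2) by (auto simp: double_cycles_def split: if_splits)
    then show thesis using turn[of "n div 2" "j - 2 * b n" k] x 3 by simp
  qed
qed

lemma cycle_swap_simps:
  "j < b n \<Longrightarrow> cycle_swap b (n, j, k) = (n, b n + j, k)"
  "j < b n \<Longrightarrow> cycle_swap b (n, b n + j, k) = (n, j, k)"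
  "cycle_swap b (2 * n, 2 * b (2 * n) + j, k) = (2 * n, 2 * b (2 * n) + j, (k + n) mod max 1 (2 * n))"
  by (simp_all add: cycle_swap_def)

lemma cycle_halve_simps:
  "j < b n \<Longrightarrow> cycle_halve b (n, j, k) = (n, j, k)"
  "j < b n \<Longrightarrow> cycle_halve b (n, b n + j, k) = (n, j, k)"
  "cycle_halve b (2 * n, 2 * b (2 * n) + j, k) = (n, b n + j, k mod max 1 n)"
  by (simp_all add: cycle_halve_def)

lemma rotate_cycles_simp: "rotate_cycles (n, j, k) = (n, j, Suc k mod max 1 n)"
  by (simp add: rotate_cycles_def)

lemma cycle_swap_in:
  assumes "x \<in> cycles (double_cycles b d)"
  shows "cycle_swap b x \<in> cycles (double_cycles b d)"
  using assms
proof (cases rule: double_cycles_cases)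
  case (turn n j k)
  then show ?thesis
    by (simp add: cycle_swap_simps) (simp add: cycles_def double_cycles_def)
qed (simp_all add: cycle_swap_simps, simp_all add: cycles_def double_cycles_def)

lemma cycle_swap_swap:
  assumes "x \<in> cycles (double_cycles b d)"
  shows "cycle_swap b (cycle_swap b x) = x"
  using assms
proof (cases rule: double_cycles_cases)
  case (turn n j k)
  have "((k + n) mod max 1 (2 * n) + n) mod max 1 (2 * n) = (k + 2 * n) mod max 1 (2 * n)"
    by (simp add: mod_add_left_eq mult_2 add.assoc)
  also have "\<dots> = k"
    using turn(3) by (cases "n = 0") auto
  finally show ?thesis
    by (simp only: turn(1) cycle_swap_simps)
qed (simp_all add: cycle_swap_simps)

lemma cycle_swap_rotate:
  assumes "x \<in> cycles (double_cycles b d)"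
  shows "cycle_swap b (rotate_cycles x) = rotate_cycles (cycle_swap b x)"
  using assms
proof (cases rule: double_cycles_cases)
  case (turn n j k)
  have "(Suc k mod max 1 (2 * n) + n) mod max 1 (2 * n) =
      Suc ((k + n) mod max 1 (2 * n)) mod max 1 (2 * n)"
    by (metis add_Suc mod_add_left_eq mod_Suc_eq)
  then show ?thesis
    by (simp only: turn(1) cycle_swap_simps rotate_cycles_simp)
qed (simp_all add: cycle_swap_simps rotate_cycles_simp)

lemma cycle_weight_rotate: "cycle_weight (rotate_cycles x) = cycle_weight x"
  by (cases x) (simp add: rotate_cycles_def cycle_weight_def)

lemma cycle_weight_swap: "cycle_weight (cycle_swap b x) = cycle_weight x"
  by (cases x) (simp add: cycle_swap_def cycle_weight_def)

lemma bij_betw_cycle_swap: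
  "bij_betw (cycle_swap b) (cycles (double_cycles b d)) (cycles (double_cycles b d))"
  by (rule bij_betw_byWitness[of _ "cycle_swap b"]) (auto simp: cycle_swap_swap cycle_swap_in)

lemma cycle_halve_rotate:
  assumes "x \<in> cycles (double_cycles b d)"
  shows "cycle_halve b (rotate_cycles x) = rotate_cycles (cycle_halve b x)"
  using assms
proof (cases rule: double_cycles_cases)
  case (turn n j k)
  \<comment> \<open>\<open>max 1 n\<close> divides \<open>max 1 (2 * n)\<close>; both are 1 at label
    0.\<close>
  have "Suc k mod max 1 (2 * n) mod max 1 n = Suc (k mod max 1 n) mod max 1 n"
    by (cases "n = 0") (simp_all add: mod_mod_cancel mod_Suc_eq)
  then show ?thesis
    by (simp only: turn(1) cycle_halve_simps rotate_cycles_simp)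
qed (simp_all add: cycle_halve_simps rotate_cycles_simp)

lemma cycle_halve_image:
  "cycle_halve b ` cycles (double_cycles b d) = cycles (\<lambda>n. b n + d n)"
proof
  show "cycle_halve b ` cycles (double_cycles b d) \<subseteq> cycles (\<lambda>n. b n + d n)"
  proof (rule image_subsetI)
    fix x assume "x \<in> cycles (double_cycles b d)"
    then show "cycle_halve b x \<in> cycles (\<lambda>n. b n + d n)"
      by (cases rule: double_cycles_cases) (simp_all only: cycle_halve_simps, auto simp: cycles_def)
  qed
  show "cycles (\<lambda>n. b n + d n) \<subseteq> cycle_halve b ` cycles (double_cycles b d)"
  proof
    fix y assume "y \<in> cycles (\<lambda>n. b n + d n)"
    then obtain n j k where y: "y = (n, j, k)" "j < b n + d n" "k < max 1 n"
      by (auto simp: cycles_def)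
    show "y \<in> cycle_halve b ` cycles (double_cycles b d)"
    proof (cases "j < b n")
      case True
      then have "(n, j, k) \<in> cycles (double_cycles b d)"
        using y by (simp add: cycles_def double_cycles_def)
      with True y show ?thesis
        by (metis cycle_halve_simps(1) image_eqI)
    next
      case False
      \<comment> \<open>A cycle with index at least \<open>b n\<close> comes from a turned cycle of
        twice the label, where folding leaves position \<open>k\<close> unchanged.\<close>
      let ?x = "(2 * n, 2 * b (2 * n) + (j - b n), k)"
      have "?x \<in> cycles (double_cycles b d)"
        using y False by (auto simp: cycles_def double_cycles_def)
      moreover have "cycle_halve b ?x = y"
        unfolding y(1) cycle_halve_simps(3) using y(2,3) False by simp
      ultimately show ?thesis by blast
    qed
  qed
qed

text \<open>Folding a cycle of length \<open>2 * m\<close> identifies exactly the opposite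
  positions; for \<open>m = 0\<close> there is only one position.\<close>

lemma mod_half_eq_iff:
  fixes k l m :: nat
  assumes "k < max 1 (2 * m)" "l < max 1 (2 * m)"
  shows "k mod max 1 m = l mod max 1 m \<longleftrightarrow> l = k \<or> l = (k + m) mod max 1 (2 * m)"
proof (cases "m = 0")
  case False
  then have *: "x mod m = (if x < m then x else x - m)"
    "(x + m) mod (2 * m) = (if x < m then x + m else x - m)" if "x < 2 * m" for x
    using that by (auto simp: le_mod_geq)
  show ?thesis
    using False assms *[of k] *[of l] by (simp add: max_def) linarith
qed (use assms in auto)

text \<open>Images of swapped cycles have index below \<open>b n\<close>, those of turned cycles at
  least \<open>b n\<close>, so the two kinds never collide; within the turned kind the positions
  decide.\<close>

lemma cycle_halve_eq_iff:
  assumes x: "x \<in> cycles (double_cycles b d)" and y: "y \<in> cycles (double_cycles b d)"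
  shows "cycle_halve b x = cycle_halve b y \<longleftrightarrow> y = x \<or> y = cycle_swap b x"
  using x
proof (cases rule: double_cycles_cases)
  case (left n j k)
  from y show ?thesis
    by (cases rule: double_cycles_cases) (use left in \<open>auto simp: cycle_halve_simps cycle_swap_simps\<close>)
next
  case (right n j k)
  from y show ?thesis
    by (cases rule: double_cycles_cases) (use right in \<open>auto simp: cycle_halve_simps cycle_swap_simps\<close>)
next
  case x: (turn n j k)
  from y show ?thesis
  proof (cases rule: double_cycles_cases)
    case y: (turn m i l)
    show ?thesis
      using mod_half_eq_iff[of k n l] x y
      by (simp only: cycle_halve_simps cycle_swap_simps) auto
  qed (use x in \<open>auto simp: cycle_halve_simps cycle_swap_simps\<close>)
qed

section \<open>Realization of the cycle system by a metric on a set of reals\<close>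

text \<open>By parity the condition at 0 forces \<open>b 0 = 0\<close> and \<open>d 0 = 1\<close>: a
  single point of label 0, of the turned kind and fixed by the involution, which becomes the point
  at infinity.\<close>

lemma halving_realization:
  fixes b d :: "nat \<Rightarrow> nat"
  assumes 0: "double_cycles b d 0 = 1"
  shows "\<exists>(X :: real metric) T i.
    topological_dynamical_system X T \<and>
    continuous_involution (mtopology_of X) i \<and>
    (\<forall>x\<in>mspace X. i (T x) = T (i x)) \<and>
    (\<forall>n\<ge>2. orbit_count (mspace X) T n = double_cycles b d n) \<and>
    (\<forall>n\<ge>2. orbit_count (topspace (halved_space (mtopology_of X) i))
       (halved_map (mtopology_of X) i T) n = b n + d n)"
proof -
  \<comment> \<open>The points are countable, so they embed in the reals as natural numbers; the
    metric comes from the weight instead of the usual distance.\<close>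
  define enc :: "nat \<times> nat \<times> nat \<Rightarrow> real" where "enc x = real (to_nat x)" for x
  have "inj enc"
    by (auto simp: inj_def enc_def)
  define dec where "dec = inv enc"
  have dec: "dec (enc x) = x" for x
    unfolding dec_def using \<open>inj enc\<close> by simp
  define P where "P = cycles (double_cycles b d)"
  define S where "S = enc ` P"
  have enc: "bij_betw enc P S" and bij_dec: "bij_betw dec S P"
    by (rule bij_betw_byWitness[of _ dec] bij_betw_byWitness[of _ enc]; auto simp: S_def dec)+
  define T where "T = enc \<circ> (rotate_cycles \<circ> dec)"
  define i where "i = enc \<circ> (cycle_swap b \<circ> dec)"
  define w where "w = cycle_weight \<circ> dec"
  have T: "T (enc x) = enc (rotate_cycles x)" and i: "i (enc x) = enc (cycle_swap b x)" for x
    by (simp_all add: T_def i_def dec)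
  have bij_T: "bij_betw T S S"
    unfolding T_def using bij_dec bij_betw_rotate_cycles enc
    by (auto intro!: bij_betw_trans simp: P_def)
  have bij_i: "bij_betw i S S"
    unfolding i_def using bij_dec bij_betw_cycle_swap enc
    by (auto intro!: bij_betw_trans simp: P_def)
  have w: "w (T x) = w x" "w (i x) = w x" if "x \<in> S" for x
    using that by (auto simp: S_def T i w_def dec cycle_weight_rotate cycle_weight_swap)
  have origin: "(0, 0, 0) \<in> P"
    using 0 by (simp add: P_def cycles_def)
  interpret vanishing_weight S "enc (0, 0, 0)" w
  proof
    show "enc (0, 0, 0) \<in> S" "w (enc (0, 0, 0)) = 0"
      using origin by (simp_all add: S_def w_def dec cycle_weight_def)
    show "w x > 0" if x: "x \<in> S" "x \<noteq> enc (0, 0, 0)" for x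
    proof -
      obtain n j k where n: "x = enc (n, j, k)" "j < double_cycles b d n" "k < max 1 n"
        using x(1) by (auto simp: S_def P_def cycles_def)
      then have "n \<noteq> 0"
        using x(2) 0 by (cases "n = 0") auto
      then show ?thesis
        by (simp add: n(1) w_def dec cycle_weight_def)
    qed
    show "finite {x \<in> S. w x \<ge> e}" if "e > 0" for e
    proof (rule finite_subset[OF _ finite_imageI[OF finite_cycle_weight_ge[OF that]]])
      show "{x \<in> S. w x \<ge> e} \<subseteq> enc ` {x \<in> cycles (double_cycles b d). cycle_weight x \<ge> e}"
        by (auto simp: S_def P_def w_def dec)
    qed
  qed
  define X where "X = metric (S, wdist)"
  have X: "mspace X = S" "mtopology_of X = mtopology"
    by (simp_all add: X_def)
  have funpow_T: "(T ^^ n) (enc x) = enc ((rotate_cycles ^^ n) x)" for n x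
    by (induction n) (simp_all add: T)
  have periodic: "finite {x \<in> S. (T ^^ n) x = x}" if "n \<ge> 1" for n
  proof (rule finite_subset[OF _ finite_imageI[OF finite_rotate_cycles_periodic[OF that]]])
    show "{x \<in> S. (T ^^ n) x = x} \<subseteq>
        enc ` {x \<in> cycles (double_cycles b d). (rotate_cycles ^^ n) x = x}"
      by (auto simp: S_def P_def funpow_T inj_eq[OF \<open>inj enc\<close>])
  qed
  have "topological_dynamical_system X T"
    unfolding topological_dynamical_system_def X
  proof (intro conjI)
    show "\<exists>x\<in>S. T x = x"
      using z(1) by (intro bexI[of _ "enc (0, 0, 0)"]) (simp_all add: T rotate_cycles_def)
  qed (use compact_space_wdist homeomorphic_map_weight_preserving[OF bij_T] w periodic in auto)
  moreover have inv: "continuous_involution mtopology i"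
    unfolding continuous_involution_def
  proof
    show "continuous_map mtopology mtopology i"
      by (intro homeomorphic_imp_continuous_map homeomorphic_map_weight_preserving bij_i w)
    show "\<forall>x\<in>topspace mtopology. i (i x) = x"
      unfolding topspace_mtopology by (auto simp: S_def P_def i cycle_swap_swap)
  qed
  moreover have comm: "\<forall>x\<in>S. i (T x) = T (i x)"
    by (auto simp: S_def P_def T i cycle_swap_rotate)
  moreover have "orbit_count S T n = double_cycles b d n" if "n \<ge> 2" for n
  proof -
    have "orbit_count P rotate_cycles n = orbit_count S T n"
      by (rule orbit_count_conjugate[OF enc]) (auto simp: T P_def rotate_cycles_in)
    then show ?thesis
      using orbit_count_rotate_cycles[OF that] by (simp add: P_def)
  qed
  moreover have "orbit_count (topspace (halved_space mtopology i)) (halved_map mtopology i T) n =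
      b n + d n" if "n \<ge> 2" for n
  proof -
    have "orbit_count (topspace (halved_space mtopology i)) (halved_map mtopology i T) n =
        orbit_count (cycles (\<lambda>n. b n + d n)) rotate_cycles n"
    proof (rule orbit_count_halved[OF inv, where g = "cycle_halve b \<circ> dec"], unfold topspace_mtopology)
      show "T ` S \<subseteq> S" using bij_T by (simp add: bij_betw_def)
      show "\<forall>x\<in>S. T (i x) = i (T x)" using comm by simp
      show "(cycle_halve b \<circ> dec) ` S = cycles (\<lambda>n. b n + d n)"
        by (simp add: S_def P_def image_image dec cycle_halve_image)
      show "(cycle_halve b \<circ> dec) x = (cycle_halve b \<circ> dec) y \<longleftrightarrow> y = x \<or> y = i x"
        if xy: "x \<in> S" "y \<in> S" for x y
      proof -
        obtain p q where "x = enc p" "y = enc q" "p \<in> P" "q \<in> P"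
          using xy by (auto simp: S_def)
        then show ?thesis
          by (simp add: dec i P_def cycle_halve_eq_iff inj_eq[OF \<open>inj enc\<close>])
      qed
      show "(cycle_halve b \<circ> dec) (T x) = rotate_cycles ((cycle_halve b \<circ> dec) x)" if "x \<in> S" for x
        using that by (auto simp: S_def P_def T dec cycle_halve_rotate)
    qed
    then show ?thesis
      by (simp add: orbit_count_rotate_cycles[OF that])
  qed
  ultimately show ?thesis
    by (intro exI[of _ X] exI[of _ T] exI[of _ i]) (simp add: X)
qed

section \<open>Choice of the numbers of cycles\<close>

lemma eventually_power_le_power:
  fixes r s K :: real
  assumes "0 < r" "r < s"
  shows "eventually (\<lambda>n. K * r ^ n \<le> s ^ n) sequentially"
proof -
  have "(\<lambda>n. K * (r / s) ^ n) \<longlonglongrightarrow> K * 0"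
    using assms by (intro tendsto_mult tendsto_const LIMSEQ_power_zero) simp
  then have "eventually (\<lambda>n. K * (r / s) ^ n < 1) sequentially"
    by (rule order_tendstoD) simp
  then show ?thesis
    by eventually_elim (use assms in \<open>simp add: power_divide field_simps\<close>)
qed

text \<open>An error of strictly smaller exponential rate is of lower order than the main
  term.\<close>

lemma asymp_equiv_power:
  fixes u :: "nat \<Rightarrow> real"
  assumes "0 < r" "r < s" "c > 0"
    and u: "eventually (\<lambda>n. \<bar>u n - c * s ^ n\<bar> \<le> K * r ^ n) sequentially"
  shows "u \<sim>[sequentially] (\<lambda>n. c * s ^ n)"
proof (rule smallo_imp_asymp_equiv)
  have "(\<lambda>n. u n - c * s ^ n) \<in> O(\<lambda>n. r ^ n)"
    using u assms by (intro bigoI[of _ K]) simp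
  also have "(\<lambda>n. r ^ n) \<in> o(\<lambda>n. s ^ n)"
  proof (rule smalloI_tendsto)
    have "(\<lambda>n. (r / s) ^ n) \<longlonglongrightarrow> 0"
      using assms by (intro LIMSEQ_power_zero) simp
    then show "(\<lambda>n. r ^ n / s ^ n) \<longlonglongrightarrow> 0"
      by (simp add: power_divide)
  qed (use assms in simp)
  finally show "(\<lambda>n. u n - c * s ^ n) \<in> o(\<lambda>n. c * s ^ n)"
    using assms by simp
qed

text \<open>\<open>D\<close> is the target for \<open>d\<close>. Its growth bound eventually keeps
  the \<open>d (n div 2)\<close> turned cycles of even length \<open>n\<close> within
  \<open>lam ^ n\<close>, so that swapped pairs can fill up the rest; rounding to integers and to
  pairs costs at most 2.\<close>

lemma cycle_numbers:
  fixes lam :: real and D :: "nat \<Rightarrow> real"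
  assumes lam: "lam > 1" and D: "\<And>n. D n \<ge> 0"
    and le: "eventually (\<lambda>n. D n \<le> (lam\<^sup>2) ^ n) sequentially"
  obtains b d :: "nat \<Rightarrow> nat" where
    "double_cycles b d 0 = 1"
    "\<And>n. n \<ge> 1 \<Longrightarrow> real (d n) \<le> D n"
    "\<And>n. n \<ge> 1 \<Longrightarrow> \<bar>real (d n) - D n\<bar> \<le> 1"
    "\<And>n. 2 * real (b n) \<le> lam ^ n"
    "eventually (\<lambda>n. \<bar>real (double_cycles b d n) - lam ^ n\<bar> \<le> 2) sequentially"
proof -
  \<comment> \<open>The value at 0 is the point at infinity, which is why the estimates for
    \<open>d\<close> start at 1.\<close>
  define d where "d n = (if n = 0 then 1 else nat \<lfloor>D n\<rfloor>)" for n
  define e where "e n = (if even n then d (n div 2) else 0)" for n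
  define L where "L n = nat \<lfloor>lam ^ n\<rfloor>" for n
  \<comment> \<open>Half of what the turned cycles leave over. Truncation gives 0 where they already
    exceed \<open>L n\<close>, and \<open>b 0 = 0\<close> because
    \<open>L 0 = e 0 = 1\<close>.\<close>
  define b where "b n = (L n - e n) div 2" for n
  have L: "real (L n) \<le> lam ^ n" "lam ^ n < real (L n) + 1" for n
    using lam by (simp_all add: L_def of_nat_nat)
  have d: "real (d n) \<le> D n" "\<bar>real (d n) - D n\<bar> \<le> 1" if "n \<ge> 1" for n
  proof -
    have "real (d n) = of_int \<lfloor>D n\<rfloor>"
      using that D[of n] by (simp add: d_def of_nat_nat)
    then show "real (d n) \<le> D n" "\<bar>real (d n) - D n\<bar> \<le> 1"
      by linarith+
  qed
  have total: "double_cycles b d n = 2 * b n + e n" for n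
    by (simp add: double_cycles_def e_def)
  obtain N where N: "\<And>n. n \<ge> N \<Longrightarrow> D n \<le> (lam\<^sup>2) ^ n"
    using le by (auto simp: eventually_sequentially)
  \<comment> \<open>From \<open>2 * N + 2\<close> on, half of an even \<open>n\<close> is at least
    \<open>N\<close> and at least 1, as the bounds on \<open>D\<close> and \<open>d\<close>
    require.\<close>
  have "\<bar>real (double_cycles b d n) - lam ^ n\<bar> \<le> 2" if n: "n \<ge> 2 * N + 2" for n
  proof -
    have "e n \<le> L n"
    proof (cases "even n")
      case True
      then obtain m where m: "n = 2 * m" by blast
      with n have "real (d m) \<le> (lam\<^sup>2) ^ m"
        using d(1)[of m] N[of m] by simp
      then have "real (d m) < real (L n) + 1"
        using L(2)[of n] by (simp add: m power_mult)
      then show ?thesis by (simp add: e_def m)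
    qed (simp add: e_def)
    then have "double_cycles b d n \<le> L n" "L n \<le> double_cycles b d n + 1"
      unfolding total b_def by linarith+
    with L[of n] show ?thesis by linarith
  qed
  then have ev: "eventually (\<lambda>n. \<bar>real (double_cycles b d n) - lam ^ n\<bar> \<le> 2) sequentially"
    unfolding eventually_sequentially by blast
  have b: "2 * real (b n) \<le> lam ^ n" for n
  proof -
    have "2 * b n \<le> L n" by (simp add: b_def)
    then show ?thesis using L(1)[of n] by linarith
  qed
  have "double_cycles b d 0 = 1"
    by (simp add: total b_def e_def d_def L_def)
  then show thesis
    by (rule that[OF _ d b ev])
qed

section \<open>Choice of the growth of the turned cycles\<close>

theorem corollary10:
  fixes lam eta c :: real
  assumes "lam > 1" and "eta > 0" and "c > 0"
    and "(eta = lam \<and> c \<ge> 1/2) \<or> (lam < eta \<and> eta < lam^2) \<or> (eta = lam^2 \<and> c \<le> 1)"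
  shows "\<exists>(X :: real metric) T i.
           topological_dynamical_system X T \<and>
           continuous_involution (mtopology_of X) i \<and>
           (\<forall>x\<in>mspace X. i (T x) = T (i x)) \<and>
           (\<lambda>n. real (orbit_count (mspace X) T n)) \<sim>[sequentially] (\<lambda>n. lam ^ n) \<and>
           (\<lambda>n. real (orbit_count (topspace (halved_space (mtopology_of X) i))
                        (halved_map (mtopology_of X) i T) n))
             \<sim>[sequentially] (\<lambda>n. c * eta ^ n)"
proof -
  have "\<exists>b d r K. double_cycles b d 0 = 1 \<and> 0 < r \<and> r < eta \<and>
      eventually (\<lambda>n. \<bar>real (double_cycles b d n) - lam ^ n\<bar> \<le> 2) sequentially \<and>
      eventually (\<lambda>n. \<bar>real (b n + d n) - c * eta ^ n\<bar> \<le> K * r ^ n) sequentially"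
  proof (cases "eta = lam")
    case True
    \<comment> \<open>This excludes the alternative \<open>eta = lam^2\<close>, leaving the one with
      \<open>c \<ge> 1/2\<close>.\<close>
    have "lam < lam\<^sup>2"
      using \<open>lam > 1\<close> by (simp add: power2_eq_square)
    then have c: "c \<ge> 1 / 2"
      using assms(4) True by linarith
    \<comment> \<open>The pairs will contribute about \<open>lam ^ n / 2\<close> to the halved
      count, which leaves \<open>(c - 1/2) * lam ^ n\<close> for the turned cycles.\<close>
    have le: "eventually (\<lambda>n. (c - 1/2) * lam ^ n \<le> (lam\<^sup>2) ^ n) sequentially"
      using eventually_power_le_power[OF _ \<open>lam < lam\<^sup>2\<close>] \<open>lam > 1\<close> by simp
    have nonneg: "(c - 1/2) * lam ^ n \<ge> 0" for n
      using c \<open>lam > 1\<close> by simp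
    obtain b d where 0: "double_cycles b d 0 = 1"
      and d: "\<And>n. n \<ge> 1 \<Longrightarrow> real (d n) \<le> (c - 1/2) * lam ^ n"
        "\<And>n. n \<ge> 1 \<Longrightarrow> \<bar>real (d n) - (c - 1/2) * lam ^ n\<bar> \<le> 1"
      and "\<And>n. 2 * real (b n) \<le> lam ^ n"
      and b: "eventually (\<lambda>n. \<bar>real (double_cycles b d n) - lam ^ n\<bar> \<le> 2) sequentially"
      by (rule cycle_numbers[OF \<open>lam > 1\<close> nonneg le]) (rule that)
    have r: "1 < sqrt lam" "sqrt lam < lam"
      using \<open>lam > 1\<close> real_sqrt_less_mono[OF \<open>lam < lam\<^sup>2\<close>] by auto
    \<comment> \<open>\<open>b n\<close> misses \<open>lam ^ n / 2\<close> by at most 1 plus half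
      the number of turned cycles of length \<open>n\<close>, which is at most
      \<open>c * sqrt lam ^ n\<close>; rounding \<open>d n\<close> costs 1 more. Starting at 2 keeps
      \<open>n div 2\<close> away from the special value \<open>d 0\<close>.\<close>
    have "eventually (\<lambda>n. \<bar>real (b n + d n) - c * eta ^ n\<bar> \<le> (2 + c) * sqrt lam ^ n) sequentially"
      using b eventually_ge_at_top[of 2]
    proof eventually_elim
      case (elim n)
      define e where "e = (if even n then real (d (n div 2)) else 0)"
      have "real (double_cycles b d n) = 2 * real (b n) + e"
        by (simp add: double_cycles_def e_def)
      moreover have "0 \<le> e" "e \<le> c * sqrt lam ^ n"
      proof -
        show "0 \<le> e" by (simp add: e_def)
        show "e \<le> c * sqrt lam ^ n"
        proof (cases "even n")
          case True
          then obtain m where m: "n = 2 * m" by blast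
          have "e \<le> (c - 1/2) * lam ^ m"
            using d(1)[of m] elim(2) by (simp add: e_def m)
          also have "\<dots> \<le> c * lam ^ m"
            using \<open>lam > 1\<close> by (intro mult_right_mono) auto
          finally show ?thesis
            using \<open>lam > 1\<close> by (simp add: m power_mult)
        next
          case False
          then show ?thesis using r \<open>c > 0\<close> by (simp add: e_def)
        qed
      qed
      moreover have "sqrt lam ^ n \<ge> 1"
        using r by (intro one_le_power) simp
      moreover have "\<bar>real (d n) - (c * lam ^ n - lam ^ n / 2)\<bar> \<le> 1"
        using d(2)[of n] elim(2) by (simp add: algebra_simps)
      ultimately show ?case
        using elim(1) unfolding True distrib_right abs_le_iff by (simp; linarith)
    qed
    with 0 b r \<open>eta = lam\<close> show ?thesis
      by (intro exI[of _ b] exI[of _ d] exI[of _ "sqrt lam"] exI[of _ "2 + c"]) auto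
  next
    case False
    then have eta: "lam < eta"
      using assms(1,4) by (auto simp: power2_eq_square)
    \<comment> \<open>At \<open>eta = lam^2\<close> the bound amounts to \<open>c \<le> 1\<close>;
      below it the faster exponential absorbs any \<open>c\<close>.\<close>
    have le: "eventually (\<lambda>n. c * eta ^ n \<le> (lam\<^sup>2) ^ n) sequentially"
    proof (cases "eta = lam\<^sup>2")
      case True
      with False assms have "c \<le> 1" by auto
      then show ?thesis
        using True \<open>eta > 0\<close> by (intro always_eventually allI) (simp add: mult_left_le_one_le)
    next
      case False
      with \<open>eta \<noteq> lam\<close> assms have "eta < lam\<^sup>2" by auto
      then show ?thesis
        using eventually_power_le_power \<open>eta > 0\<close> by blast
    qed
    have nonneg: "c * eta ^ n \<ge> 0" for n
      using assms(2,3) by simp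
    obtain b d where 0: "double_cycles b d 0 = 1"
      and "\<And>n. n \<ge> 1 \<Longrightarrow> real (d n) \<le> c * eta ^ n"
      and d: "\<And>n. n \<ge> 1 \<Longrightarrow> \<bar>real (d n) - c * eta ^ n\<bar> \<le> 1"
      and b: "\<And>n. 2 * real (b n) \<le> lam ^ n"
        "eventually (\<lambda>n. \<bar>real (double_cycles b d n) - lam ^ n\<bar> \<le> 2) sequentially"
      by (rule cycle_numbers[OF \<open>lam > 1\<close> nonneg le]) (rule that)
    \<comment> \<open>The main term comes from \<open>d n\<close> alone: the pairs number at most
      \<open>lam ^ n / 2\<close>, of lower order than \<open>eta ^ n\<close>, and the rounding error
      1 is at most \<open>lam ^ n\<close>.\<close>
    have "eventually (\<lambda>n. \<bar>real (b n + d n) - c * eta ^ n\<bar> \<le> 2 * lam ^ n) sequentially"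
      using eventually_ge_at_top[of 1]
    proof eventually_elim
      case (elim n)
      have "lam ^ n \<ge> 1"
        using \<open>lam > 1\<close> by (intro one_le_power) simp
      moreover have "real (b n) \<ge> 0" by simp
      ultimately show ?case
        using d[OF elim] b(1)[of n] unfolding of_nat_add by linarith
    qed
    with 0 b(2) eta \<open>lam > 1\<close> show ?thesis
      by (intro exI[of _ b] exI[of _ d] exI[of _ lam] exI[of _ 2]) auto
  qed
  then obtain b d r K where 0: "double_cycles b d 0 = 1" and r: "0 < r" "r < eta"
    and Z: "eventually (\<lambda>n. \<bar>real (double_cycles b d n) - lam ^ n\<bar> \<le> 2) sequentially"
    and Y: "eventually (\<lambda>n. \<bar>real (b n + d n) - c * eta ^ n\<bar> \<le> K * r ^ n) sequentially"
    by blast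
  \<comment> \<open>The bounded error 2 is an exponential error with \<open>r = 1\<close> and
    \<open>K = 2\<close>.\<close>
  have asymp: "(\<lambda>n. real (double_cycles b d n)) \<sim>[sequentially] (\<lambda>n. lam ^ n)"
    "(\<lambda>n. real (b n + d n)) \<sim>[sequentially] (\<lambda>n. c * eta ^ n)"
    using asymp_equiv_power[of 1 lam 1 _ 2] asymp_equiv_power[OF r \<open>c > 0\<close> Y] Z \<open>lam > 1\<close>
    by simp_all
  \<comment> \<open>The orbit counts are known from \<open>n = 2\<close> on, and finitely many terms
    do not affect the asymptotics.\<close>
  have eq: "(\<lambda>n. real (f n)) \<sim>[sequentially] v"
    if "\<forall>n\<ge>2. f n = g n" "(\<lambda>n. real (g n)) \<sim>[sequentially] v" for f g :: "nat \<Rightarrow> nat" and v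
  proof (rule asymp_equiv_cong[THEN iffD2, OF _ _ that(2)])
    show "eventually (\<lambda>n. real (f n) = real (g n)) sequentially"
      using that(1) unfolding eventually_sequentially by auto
  qed simp
  obtain X :: "real metric" and T i where XTi: "topological_dynamical_system X T"
      "continuous_involution (mtopology_of X) i" "\<forall>x\<in>mspace X. i (T x) = T (i x)"
    and counts: "\<forall>n\<ge>2. orbit_count (mspace X) T n = double_cycles b d n"
      "\<forall>n\<ge>2. orbit_count (topspace (halved_space (mtopology_of X) i))
         (halved_map (mtopology_of X) i T) n = b n + d n"
    using halving_realization[OF 0] by (elim exE conjE) (rule that)
  show ?thesis
    using XTi eq[OF counts(1) asymp(1)] eq[OF counts(2) asymp(2)] by (intro exI conjI)
qed

end
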